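(* Consider a Bayesian $M$-ary hypothesis testing problem with finite $M\ge2$, models $P_i=P_{Y|X=i}$, and prior probabilities $\mathbb{P}[\mathsf{H}_i]=\mathbb{P}[X=i]$ for $i\in\{1,\ldots,M\}$. Then $$\varepsilon_{X|Y}\le\sum_{1\le i<j\le M}\mathbb{E}\Bigl[\min\bigl\{\mathbb{P}[\mathsf{H}_i|Y],\,\mathbb{P}[\mathsf{H}_j|Y]\bigr\}\Bigr]=\sum_{1\le i<j\le M}\bigl(\mathbb{P}[\mathsf{H}_i]+\mathbb{P}[\mathsf{H}_j]\bigr)\,\varepsilon_{X_{ij}|Y_{ij}},$$ where $Y\sim P_Y=\sum_{m=1}^M\mathbb{P}[\mathsf{H}_m]P_m$ and $\varepsilon_{X_{ij}|Y_{ij}}$ is the minimum error probability of the binary hypothesis test between $P_i$ and $P_j$ with priors proportional to $\mathbb{P}[\mathsf{H}_i]$ and $\mathbb{P}[\mathsf{H}_j]$.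
   Context: $X$ takes values in $\{1,\ldots,M\}$, $P_i$ are probability measures on a common measurable space $\mathcal{Y}$, and $Y$ has law $P_i$ conditionally on $X=i$. $\mathbb{P}[\mathsf{H}_i|Y]=\mathbb{P}[X=i|Y]$ is the posterior probability of hypothesis $i$. The minimum error probability of guessing $X$ from $Y$ is $\varepsilon_{X|Y}=\min_{\mathcal{L}}\mathbb{P}[X\ne\mathcal{L}(Y)]=1-\mathbb{E}[\max_m\mathbb{P}[\mathsf{H}_m|Y]]$. For $i\ne j$, $X_{ij}$ is the restriction of $X$ to $\{i,j\}$: $$\mathbb{P}[X_{ij}=i]=\frac{\mathbb{P}[\mathsf{H}_i]}{\mathbb{P}[\mathsf{H}_i]+\mathbb{P}[\mathsf{H}_j]},\qquad\mathbb{P}[X_{ij}=j]=\frac{\mathbb{P}[\mathsf{H}_j]}{\mathbb{P}[\mathsf{H}_i]+\mathbb{P}[\mathsf{H}_j]},$$ and $Y_{ij}$ has law $P_i$ given $X_{ij}=i$ and law $P_j$ given $X_{ij}=j$, so $Y_{ij}\sim\mathbb{P}[X_{ij}=i]P_i+\mathbb{P}[X_{ij}=j]P_j$. Then $$\varepsilon_{X_{ij}|Y_{ij}}=\mathbb{E}\bigl[\min\{\mathbb{P}[X_{ij}=i|Y_{ij}],\,\mathbb{P}[X_{ij}=j|Y_{ij}]\}\bigr].$$ If $\mathbb{P}[\mathsf{H}_i]+\mathbb{P}[\mathsf{H}_j]=0$ the corresponding summand in the last sum is read as $0$. *)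

theory Defs
  imports "HOL-Probability.Probability"
begin

text \<open>
  A Bayesian hypothesis test on a probability space \<open>\<Omega>\<close>: the hypothesis \<open>X\<close> ranges over a finite
  index set \<open>I\<close>, and the observation \<open>Y\<close> in the measurable space \<open>N\<close> has law \<open>P i\<close> conditionally
  on \<open>X = i\<close>. The conditional law is constrained only when the hypothesis has positive prior.
\<close>

locale bayesian_test = prob_space \<Omega>
  for \<Omega> :: "'a measure" +
  fixes I :: "nat set" and N :: "'b measure" and P :: "nat \<Rightarrow> 'b measure"
    and X :: "'a \<Rightarrow> nat" and Y :: "'a \<Rightarrow> 'b"
  assumes finite_hypotheses: "finite I"
    and X_measurable: "X \<in> measurable \<Omega> (count_space I)"
    and Y_measurable: "Y \<in> measurable \<Omega> N"
    and model_prob_space: "i \<in> I \<Longrightarrow> prob_space (P i)"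
    and model_sets: "i \<in> I \<Longrightarrow> sets (P i) = sets N"
    and conditional_law:
      "i \<in> I \<Longrightarrow> \<P>(\<omega> in \<Omega>. X \<omega> = i) > 0 \<Longrightarrow> B \<in> sets N \<Longrightarrow>
        \<P>(\<omega> in \<Omega>. Y \<omega> \<in> B \<bar> X \<omega> = i) = measure (P i) B"

definition prior :: "'a measure \<Rightarrow> ('a \<Rightarrow> nat) \<Rightarrow> nat \<Rightarrow> real" where
  "prior \<Omega> X i = \<P>(\<omega> in \<Omega>. X \<omega> = i)"

text \<open>
  The posterior probability is a random variable on \<open>\<Omega>\<close>: the conditional expectation of the
  indicator of \<open>X = i\<close> given the sigma-algebra generated by \<open>Y\<close>.
\<close>

definition posterior ::
    "'a measure \<Rightarrow> 'b measure \<Rightarrow> ('a \<Rightarrow> nat) \<Rightarrow> ('a \<Rightarrow> 'b) \<Rightarrow> nat \<Rightarrow> 'a \<Rightarrow> real" where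
  "posterior \<Omega> N X Y i =
    real_cond_exp \<Omega> (vimage_algebra (space \<Omega>) Y N) (indicator {\<omega> \<in> space \<Omega>. X \<omega> = i})"

text \<open>
  The minimum over all measurable decision rules is written as an infimum; it is attained by
  choosing a hypothesis of maximal posterior probability.
\<close>

definition min_error_prob ::
    "'a measure \<Rightarrow> nat set \<Rightarrow> 'b measure \<Rightarrow> ('a \<Rightarrow> nat) \<Rightarrow> ('a \<Rightarrow> 'b) \<Rightarrow> real" where
  "min_error_prob \<Omega> I N X Y =
    (INF L \<in> measurable N (count_space I). \<P>(\<omega> in \<Omega>. X \<omega> \<noteq> L (Y \<omega>)))"

lemma (in bayesian_test) observation_law:
  assumes B: "B \<in> sets N"
  shows "measure (distr \<Omega> N Y) B = (\<Sum>m\<in>I. prior \<Omega> X m * measure (P m) B)"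
proof -
  note [measurable] = X_measurable Y_measurable B
  have X_in: "X \<omega> \<in> I" if "\<omega> \<in> space \<Omega>" for \<omega>
    using measurable_space[OF X_measurable that] by simp
  have X_sets [measurable]: "{\<omega> \<in> space \<Omega>. X \<omega> = m} \<in> events" if "m \<in> I" for m
  proof -
    have "X -` {m} \<inter> space \<Omega> \<in> events"
      using that by (intro measurable_sets[OF X_measurable]) auto
    also have "X -` {m} \<inter> space \<Omega> = {\<omega> \<in> space \<Omega>. X \<omega> = m}" by auto
    finally show ?thesis .
  qed
  have Y_sets: "{\<omega> \<in> space \<Omega>. Y \<omega> \<in> B} \<in> events" by measurable
  define A where "A m = {\<omega> \<in> space \<Omega>. Y \<omega> \<in> B \<and> X \<omega> = m}" for m
  have A_sets: "A m \<in> events" if "m \<in> I" for m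
  proof -
    have "A m = {\<omega> \<in> space \<Omega>. Y \<omega> \<in> B} \<inter> {\<omega> \<in> space \<Omega>. X \<omega> = m}" by (auto simp: A_def)
    then show ?thesis using Y_sets X_sets[OF that] by simp
  qed
  have "measure (distr \<Omega> N Y) B = prob (\<Union>m\<in>I. A m)"
    by (subst measure_distr) (auto simp: A_def B X_in Y_measurable intro!: arg_cong[where f=prob])
  also have "\<dots> = (\<Sum>m\<in>I. prob (A m))"
    using A_sets finite_hypotheses
    by (intro finite_measure_finite_Union) (auto simp: disjoint_family_on_def A_def)
  also have "\<dots> = (\<Sum>m\<in>I. prior \<Omega> X m * measure (P m) B)"
  proof (rule sum.cong[OF refl])
    fix m assume m: "m \<in> I"
    show "prob (A m) = prior \<Omega> X m * measure (P m) B"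
    proof (cases "prob {\<omega> \<in> space \<Omega>. X \<omega> = m} > 0")
      case True
      then show ?thesis
        using conditional_law[OF m True B] by (simp add: cond_prob_def A_def prior_def field_simps)
    next
      case False
      then have "prob {\<omega> \<in> space \<Omega>. X \<omega> = m} = 0" by (simp add: zero_less_measure_iff)
      moreover have "prob (A m) \<le> prob {\<omega> \<in> space \<Omega>. X \<omega> = m}"
        using X_sets[OF m] by (intro finite_measure_mono) (auto simp: A_def)
      ultimately show ?thesis by (simp add: prior_def order_antisym)
    qed
  qed
  finally show ?thesis .
qed

end

theory Submission imports Defs begin

text \<open>
  The integral of the posterior of \<open>i\<close> over \<open>Y \<in> B\<close> is \<open>prior i * P i (B)\<close>, so the error of a rule
  \<open>L\<close> is the expected sum of the posteriors of all hypotheses other than \<open>L Y\<close>. If \<open>L Y\<close> has maximal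
  posterior, each summand is the minimum of the posteriors of one pair, which gives the bound.
  For the identity, the expected minimum of two posteriors is the least value of
  \<open>prior i * P i (B) + prior j * P j (- B)\<close> over the measurable sets \<open>B\<close>. This expression involves
  neither the probability space nor the other hypotheses, and up to the factor \<open>prior i + prior j\<close>
  it is the error in the binary test of the rule deciding for \<open>j\<close> on \<open>B\<close>.
\<close>

section \<open>Preliminaries: a bound by pairwise minima, and factorization through an
  observation\<close>

text \<open>Since \<open>p l\<close> is maximal, \<open>p i = min (p i) (p l)\<close>, so each
  \<open>i\<close> other than \<open>l\<close> is charged to the pair formed by \<open>i\<close> and
  \<open>l\<close>. Distinct \<open>i\<close> give distinct pairs, and the remaining pairs
  contribute nonnegative terms.\<close>

lemma sum_others_le_sum_pairs_min:
  fixes p :: "nat \<Rightarrow> real"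
  assumes "l \<in> {1..M}" "\<And>i. i \<in> {1..M} \<Longrightarrow> 0 \<le> p i" "\<And>i. i \<in> {1..M} \<Longrightarrow> p i \<le> p l"
  shows "(\<Sum>i\<in>{1..M} - {l}. p i) \<le> (\<Sum>(i, j)\<in>{(i, j). 1 \<le> i \<and> i < j \<and> j \<le> M}. min (p i) (p j))"
proof -
  \<comment> \<open>\<open>?h i\<close> is the pair of \<open>i\<close> and \<open>l\<close> in
    increasing order, as membership in \<open>?S\<close> demands.\<close>
  let ?S = "{(i, j). 1 \<le> i \<and> i < j \<and> j \<le> M}" and ?h = "\<lambda>i. (min i l, max i l)"
  have fin: "finite ?S" by (rule finite_subset[of _ "{1..M} \<times> {1..M}"]) auto
  have inj: "inj_on ?h ({1..M} - {l})" by (auto simp: inj_on_def min_def max_def split: if_splits)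
  have "(\<Sum>i\<in>{1..M} - {l}. p i) = (\<Sum>i\<in>{1..M} - {l}. case ?h i of (a, b) \<Rightarrow> min (p a) (p b))"
  proof (rule sum.cong[OF refl])
    fix i assume "i \<in> {1..M} - {l}"
    then have "p i \<le> p l" using assms(3) by blast
    then show "p i = (case ?h i of (a, b) \<Rightarrow> min (p a) (p b))" by (cases "i \<le> l") auto
  qed
  also have "\<dots> = (\<Sum>(a, b)\<in>?h ` ({1..M} - {l}). min (p a) (p b))"
    by (subst sum.reindex[OF inj]) simp
  also have "\<dots> \<le> (\<Sum>(a, b)\<in>?S. min (p a) (p b))"
    using assms(1,2) by (intro sum_mono2[OF fin]) (auto simp: min_def max_def)
  finally show ?thesis .
qed

text \<open>A Doob-Dynkin factorization for countably many values: each level set of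
  \<open>f\<close> is the preimage under \<open>Y\<close> of some measurable set, and
  \<open>L\<close> is read off from these sets. It turns a choice made on the sample space into a
  decision rule on observations.\<close>

lemma vimage_algebra_factor_countable:
  fixes f :: "'a \<Rightarrow> nat"
  assumes f: "f \<in> measurable (vimage_algebra A Y N) (count_space I)"
    and Y: "Y \<in> A \<rightarrow> space N" and "I \<noteq> {}"
  obtains L where "L \<in> measurable N (count_space I)" "\<And>x. x \<in> A \<Longrightarrow> L (Y x) = f x"
proof -
  obtain i\<^sub>0 where i0: "i\<^sub>0 \<in> I" using \<open>I \<noteq> {}\<close> by blast
  have "\<exists>D. D \<in> sets N \<and> f -` {m} \<inter> A = Y -` D \<inter> A" if "m \<in> I" for m
    using measurable_sets[OF f, of "{m}"] that by (auto simp: sets_vimage_algebra2[OF Y])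
  then obtain D where D: "\<And>m. m \<in> I \<Longrightarrow> D m \<in> sets N"
      "\<And>m. m \<in> I \<Longrightarrow> f -` {m} \<inter> A = Y -` D m \<inter> A"
    by metis
  \<comment> \<open>Empty sets outside \<open>I\<close> make the family measurable for every natural
    index, so that \<open>L\<close> can be defined by \<open>LEAST\<close> over all
    naturals.\<close>
  define E where "E m = (if m \<in> I then D m else {})" for m
  have [measurable]: "E m \<in> sets N" for m using D(1) by (simp add: E_def)
  \<comment> \<open>Off the range of \<open>Y\<close> the sets \<open>E m\<close> may overlap or
    fail to cover; \<open>LEAST\<close> and the default \<open>i\<^sub>0\<close> still give a value
    in \<open>I\<close>.\<close>
  define L where "L y = (if \<exists>m. y \<in> E m then LEAST m. y \<in> E m else i\<^sub>0)" for y
  have "L \<in> measurable N (count_space UNIV)" unfolding L_def by measurable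
  moreover have L_in: "L y \<in> I" for y
  proof (cases "\<exists>m. y \<in> E m")
    case True
    then have "y \<in> E (L y)" by (auto simp: L_def intro: LeastI)
    then show ?thesis by (auto simp: E_def split: if_splits)
  qed (simp add: L_def i0)
  ultimately have "L \<in> measurable N (count_space I)"
    by (intro measurable_count_space_extend[of I UNIV]) auto
  moreover have "L (Y x) = f x" if x: "x \<in> A" for x
  proof -
    have fx: "f x \<in> I" using measurable_space[OF f] x by simp
    have "Y x \<in> E m \<longleftrightarrow> m = f x" for m
    proof (cases "m \<in> I")
      case True
      then have "x \<in> f -` {m} \<inter> A \<longleftrightarrow> x \<in> Y -` D m \<inter> A" using D(2) by simp
      with True x show ?thesis by (auto simp: E_def)
    next
      case False
      with fx show ?thesis by (auto simp: E_def)
    qed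
    moreover have "(LEAST m. m = f x) = f x" by (rule Least_equality) auto
    ultimately show ?thesis by (simp add: L_def)
  qed
  ultimately show ?thesis by (rule that)
qed

section \<open>The sigma-algebra of the observation and the posteriors\<close>

context bayesian_test
begin

abbreviation "observed \<equiv> vimage_algebra (space \<Omega>) Y N"

lemma Y_space: "Y \<in> space \<Omega> \<rightarrow> space N"
  using Y_measurable by (auto dest: measurable_space)

lemma X_in: "\<omega> \<in> space \<Omega> \<Longrightarrow> X \<omega> \<in> I"
  using X_measurable by (auto dest: measurable_space)

lemma sets_observed: "sets observed = {Y -` B \<inter> space \<Omega> | B. B \<in> sets N}"
  by (rule sets_vimage_algebra2[OF Y_space])

lemma subalgebra_observed: "subalgebra \<Omega> observed"
  using Y_measurable by (auto simp: subalgebra_def sets_observed intro: measurable_sets)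

sublocale observed: finite_measure_subalgebra \<Omega> observed
  by unfold_locales (rule subalgebra_observed)

lemma X_sets [measurable]: "{\<omega> \<in> space \<Omega>. X \<omega> = i} \<in> events"
proof (cases "i \<in> I")
  case True
  then have "X -` {i} \<inter> space \<Omega> \<in> events" by (intro measurable_sets[OF X_measurable]) auto
  moreover have "X -` {i} \<inter> space \<Omega> = {\<omega> \<in> space \<Omega>. X \<omega> = i}" by auto
  ultimately show ?thesis by simp
next
  case False
  then have "{\<omega> \<in> space \<Omega>. X \<omega> = i} = {}" using X_in by auto
  then show ?thesis by (simp only: sets.empty_sets)
qed

lemma integrable_X_indicator: "integrable \<Omega> (indicator {\<omega> \<in> space \<Omega>. X \<omega> = i} :: 'a \<Rightarrow> real)"
  by (rule integrable_real_indicator) (auto simp: less_top[symmetric])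

lemma posterior_measurable_observed [measurable]: "posterior \<Omega> N X Y i \<in> borel_measurable observed"
  by (simp add: posterior_def)

lemma integrable_posterior [simp]: "integrable \<Omega> (posterior \<Omega> N X Y i)"
  unfolding posterior_def by (intro observed.real_cond_exp_int) (rule integrable_X_indicator)

lemma posterior_measurable [measurable]: "posterior \<Omega> N X Y i \<in> borel_measurable \<Omega>"
  by (rule borel_measurable_integrable) simp

lemma AE_posterior_nonneg: "AE \<omega> in \<Omega>. 0 \<le> posterior \<Omega> N X Y i \<omega>"
  unfolding posterior_def by (rule observed.real_cond_exp_pos) auto

text \<open>For positive prior this is the conditional law multiplied out. For prior 0 the
  conditional law is unconstrained, but both sides vanish by monotonicity.\<close>

lemma prob_joint:
  assumes i: "i \<in> I" and B: "B \<in> sets N"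
  shows "prob {\<omega> \<in> space \<Omega>. Y \<omega> \<in> B \<and> X \<omega> = i} = prior \<Omega> X i * measure (P i) B"
proof (cases "prob {\<omega> \<in> space \<Omega>. X \<omega> = i} > 0")
  case True
  then show ?thesis
    using conditional_law[OF i True B] by (simp add: cond_prob_def prior_def field_simps)
next
  case False
  then have "prob {\<omega> \<in> space \<Omega>. X \<omega> = i} = 0" by (simp add: zero_less_measure_iff)
  moreover have "prob {\<omega> \<in> space \<Omega>. Y \<omega> \<in> B \<and> X \<omega> = i} \<le> prob {\<omega> \<in> space \<Omega>. X \<omega> = i}"
    using X_sets by (intro finite_measure_mono) auto
  ultimately show ?thesis by (simp add: prior_def order_antisym)
qed

lemma integrable_indicator_posterior [simp]:
  assumes [measurable]: "B \<in> sets N"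
  shows "integrable \<Omega> (\<lambda>\<omega>. indicator B (Y \<omega>) * posterior \<Omega> N X Y i \<omega>)"
proof (rule Bochner_Integration.integrable_bound[OF integrable_posterior[of i]])
  note [measurable] = Y_measurable
  show "(\<lambda>\<omega>. indicator B (Y \<omega>) * posterior \<Omega> N X Y i \<omega>) \<in> borel_measurable \<Omega>" by measurable
qed (auto simp: indicator_def)

text \<open>The event that \<open>Y\<close> lies in \<open>B\<close> belongs to
  \<open>observed\<close>, so under the integral over it the conditional expectation may be replaced
  by the indicator of \<open>X = i\<close>. This links the posteriors to the models
  \<open>P i\<close>.\<close>

lemma integral_indicator_posterior:
  assumes i: "i \<in> I" and B: "B \<in> sets N"
  shows "(\<integral>\<omega>. indicator B (Y \<omega>) * posterior \<Omega> N X Y i \<omega> \<partial>\<Omega>) = prior \<Omega> X i * measure (P i) B"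
proof -
  let ?X = "{\<omega> \<in> space \<Omega>. X \<omega> = i}" and ?B = "Y -` B \<inter> space \<Omega>"
  have "(\<integral>\<omega>. indicator B (Y \<omega>) * posterior \<Omega> N X Y i \<omega> \<partial>\<Omega>)
      = (LINT \<omega>:?B|\<Omega>. real_cond_exp \<Omega> observed (indicator ?X) \<omega>)"
    unfolding set_lebesgue_integral_def posterior_def
    by (intro Bochner_Integration.integral_cong) (auto simp: indicator_def)
  also have "\<dots> = (LINT \<omega>:?B|\<Omega>. indicator ?X \<omega>)"
    using B by (intro observed.real_cond_exp_intA[symmetric])
      (auto simp: sets_observed integrable_X_indicator)
  also have "\<dots> = (\<integral>\<omega>. indicator {\<omega> \<in> space \<Omega>. Y \<omega> \<in> B \<and> X \<omega> = i} \<omega> \<partial>\<Omega>)"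
    unfolding set_lebesgue_integral_def
    by (intro Bochner_Integration.integral_cong) (auto simp: indicator_def)
  also have "\<dots> = prob {\<omega> \<in> space \<Omega>. Y \<omega> \<in> B \<and> X \<omega> = i}"
    by (simp add: Int_def conj_commute cong: conj_cong)
  finally show ?thesis using prob_joint[OF i B] by simp
qed

section \<open>Error probabilities of decision rules\<close>

text \<open>The error event is split by the true hypothesis. The resulting formula depends on
  \<Omega>, \<open>X\<close> and \<open>Y\<close> only through the priors, which makes tests on
  different probability spaces comparable.\<close>

lemma error_prob_eq_sum:
  assumes L: "L \<in> measurable N (count_space I)"
  shows "\<P>(\<omega> in \<Omega>. X \<omega> \<noteq> L (Y \<omega>)) =
    (\<Sum>i\<in>I. prior \<Omega> X i * measure (P i) {y \<in> space N. L y \<noteq> i})"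
proof -
  let ?A = "\<lambda>i. {\<omega> \<in> space \<Omega>. Y \<omega> \<in> {y \<in> space N. L y \<noteq> i} \<and> X \<omega> = i}"
  have B: "{y \<in> space N. L y \<noteq> i} \<in> sets N" for i using L by measurable
  have A: "?A i \<in> events" for i
  proof -
    have "?A i = (Y -` {y \<in> space N. L y \<noteq> i} \<inter> space \<Omega>) \<inter> {\<omega> \<in> space \<Omega>. X \<omega> = i}" by auto
    then show ?thesis using measurable_sets[OF Y_measurable B] X_sets by auto
  qed
  have "{\<omega> \<in> space \<Omega>. X \<omega> \<noteq> L (Y \<omega>)} = (\<Union>i\<in>I. ?A i)" using X_in Y_space by auto
  also have "prob \<dots> = (\<Sum>i\<in>I. prob (?A i))"
    using A finite_hypotheses
    by (intro finite_measure_finite_Union) (auto simp: disjoint_family_on_def)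
  finally show ?thesis using prob_joint[OF _ B] by simp
qed

text \<open>Each term of \<open>error_prob_eq_sum\<close> is the integral of a posterior over the
  event that the rule does not choose \<open>i\<close>; pointwise these indicators remove exactly
  the summand \<open>i = L (Y \<omega>)\<close>.\<close>

lemma error_prob_eq_integral:
  assumes L: "L \<in> measurable N (count_space I)"
  shows "\<P>(\<omega> in \<Omega>. X \<omega> \<noteq> L (Y \<omega>)) =
    (\<integral>\<omega>. (\<Sum>i\<in>I - {L (Y \<omega>)}. posterior \<Omega> N X Y i \<omega>) \<partial>\<Omega>)"
proof -
  have B: "{y \<in> space N. L y \<noteq> i} \<in> sets N" for i using L by measurable
  have "\<P>(\<omega> in \<Omega>. X \<omega> \<noteq> L (Y \<omega>)) =
      (\<integral>\<omega>. (\<Sum>i\<in>I. indicator {y \<in> space N. L y \<noteq> i} (Y \<omega>) * posterior \<Omega> N X Y i \<omega>) \<partial>\<Omega>)"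
    using B by (simp add: error_prob_eq_sum[OF L] integral_indicator_posterior)
  also have "\<dots> = (\<integral>\<omega>. (\<Sum>i\<in>I - {L (Y \<omega>)}. posterior \<Omega> N X Y i \<omega>) \<partial>\<Omega>)"
    using Y_space finite_hypotheses
    by (intro Bochner_Integration.integral_cong refl sum.mono_neutral_cong_right) (auto simp: indicator_def)
  finally show ?thesis .
qed

lemma min_error_prob_le:
  assumes "L \<in> measurable N (count_space I)"
  shows "min_error_prob \<Omega> I N X Y \<le> \<P>(\<omega> in \<Omega>. X \<omega> \<noteq> L (Y \<omega>))"
  unfolding min_error_prob_def using assms by (intro cINF_lower bdd_belowI[of _ 0]) auto

lemma integrable_min_posterior:
  "integrable \<Omega> (\<lambda>\<omega>. min (posterior \<Omega> N X Y i \<omega>) (posterior \<Omega> N X Y j \<omega>))"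
  by (intro integrable_min integrable_posterior)

text \<open>A maximizing index is first chosen on \<Omega>, with ties broken by the least index so
  that the choice is measurable with respect to \<open>observed\<close>; it then factors through
  \<open>Y\<close>. Maximality holds at every sample point, not just almost everywhere.\<close>

lemma obtain_maximal_posterior_rule:
  obtains L where "L \<in> measurable N (count_space I)"
    "\<And>\<omega> i. \<omega> \<in> space \<Omega> \<Longrightarrow> i \<in> I \<Longrightarrow>
      posterior \<Omega> N X Y i \<omega> \<le> posterior \<Omega> N X Y (L (Y \<omega>)) \<omega>"
proof -
  let ?p = "posterior \<Omega> N X Y"
  define f where "f \<omega> = (LEAST m. m \<in> I \<and> (\<forall>k\<in>I. ?p k \<omega> \<le> ?p m \<omega>))" for \<omega>
  have "I \<noteq> {}" using X_in not_empty by auto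
  have f: "f \<omega> \<in> I \<and> (\<forall>k\<in>I. ?p k \<omega> \<le> ?p (f \<omega>) \<omega>)" for \<omega>
  proof -
    have "Max ((\<lambda>m. ?p m \<omega>) ` I) \<in> (\<lambda>m. ?p m \<omega>) ` I"
      using finite_hypotheses \<open>I \<noteq> {}\<close> by (intro Max_in) auto
    then obtain m where "m \<in> I" "Max ((\<lambda>m. ?p m \<omega>) ` I) = ?p m \<omega>" by auto
    then have "m \<in> I \<and> (\<forall>k\<in>I. ?p k \<omega> \<le> ?p m \<omega>)"
      using finite_hypotheses by (metis Max_ge finite_imageI imageI)
    then show ?thesis unfolding f_def by (rule LeastI)
  qed
  have "countable I" using finite_hypotheses by (rule countable_finite)
  have "f \<in> measurable observed (count_space UNIV)"
    unfolding f_def using \<open>countable I\<close> by measurable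
  then have "f \<in> measurable observed (count_space I)"
    using f by (intro measurable_count_space_extend[of I UNIV]) auto
  then obtain L where "L \<in> measurable N (count_space I)" "\<And>\<omega>. \<omega> \<in> space \<Omega> \<Longrightarrow> L (Y \<omega>) = f \<omega>"
    using vimage_algebra_factor_countable[OF _ Y_space \<open>I \<noteq> {}\<close>] by blast
  with f show ?thesis by (intro that) auto
qed

section \<open>The expected minimum of two posteriors as a minimum over measurable sets\<close>

text \<open>The pointwise minimum is at most the posterior of \<open>i\<close> where
  \<open>Y\<close> lies in \<open>B\<close> and at most that of \<open>j\<close> elsewhere;
  integrating these two bounds gives the right-hand side.\<close>

lemma integral_min_posterior_le:
  assumes ij: "i \<in> I" "j \<in> I" and B: "B \<in> sets N"
  shows "(\<integral>\<omega>. min (posterior \<Omega> N X Y i \<omega>) (posterior \<Omega> N X Y j \<omega>) \<partial>\<Omega>) \<le>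
    prior \<Omega> X i * measure (P i) B + prior \<Omega> X j * measure (P j) (space N - B)"
proof -
  let ?p = "posterior \<Omega> N X Y"
  have C: "space N - B \<in> sets N" using B by auto
  have "(\<integral>\<omega>. min (?p i \<omega>) (?p j \<omega>) \<partial>\<Omega>) \<le>
      (\<integral>\<omega>. indicator B (Y \<omega>) * ?p i \<omega> + indicator (space N - B) (Y \<omega>) * ?p j \<omega> \<partial>\<Omega>)"
    using B C Y_space
    by (intro integral_mono integrable_min_posterior Bochner_Integration.integrable_add
        integrable_indicator_posterior)
      (auto simp: indicator_def)
  then show ?thesis using B C ij by (simp add: integral_indicator_posterior)
qed

text \<open>The set where the posterior of \<open>i\<close> is at most that of \<open>j\<close> lies
  in \<open>observed\<close>, hence is the preimage of some \<open>B\<close>. For this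
  \<open>B\<close> the bound of \<open>integral_min_posterior_le\<close> is a pointwise
  equality.\<close>

lemma integral_min_posterior_attained:
  assumes ij: "i \<in> I" "j \<in> I"
  obtains B where "B \<in> sets N"
    "(\<integral>\<omega>. min (posterior \<Omega> N X Y i \<omega>) (posterior \<Omega> N X Y j \<omega>) \<partial>\<Omega>) =
      prior \<Omega> X i * measure (P i) B + prior \<Omega> X j * measure (P j) (space N - B)"
proof -
  let ?p = "posterior \<Omega> N X Y"
  have "{\<omega> \<in> space observed. ?p i \<omega> \<le> ?p j \<omega>} \<in> sets observed" by measurable
  then obtain B where B: "B \<in> sets N" and eq: "{\<omega> \<in> space \<Omega>. ?p i \<omega> \<le> ?p j \<omega>} = Y -` B \<inter> space \<Omega>"
    by (auto simp: sets_observed)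
  have C: "space N - B \<in> sets N" using B by auto
  have Y_B: "Y \<omega> \<in> B \<longleftrightarrow> ?p i \<omega> \<le> ?p j \<omega>" if "\<omega> \<in> space \<Omega>" for \<omega> using eq that by auto
  have "(\<integral>\<omega>. min (?p i \<omega>) (?p j \<omega>) \<partial>\<Omega>) =
      (\<integral>\<omega>. indicator B (Y \<omega>) * ?p i \<omega> + indicator (space N - B) (Y \<omega>) * ?p j \<omega> \<partial>\<Omega>)"
    using Y_space by (intro Bochner_Integration.integral_cong) (auto simp: indicator_def Y_B)
  with B C ij show ?thesis by (intro that[OF B]) (simp add: integral_indicator_posterior)
qed

lemma integral_posterior:
  assumes "i \<in> I"
  shows "(\<integral>\<omega>. posterior \<Omega> N X Y i \<omega> \<partial>\<Omega>) = prior \<Omega> X i"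
proof -
  have "(\<integral>\<omega>. posterior \<Omega> N X Y i \<omega> \<partial>\<Omega>) = (\<integral>\<omega>. indicator {\<omega> \<in> space \<Omega>. X \<omega> = i} \<omega> \<partial>\<Omega>)"
    unfolding posterior_def by (intro observed.real_cond_exp_int) (rule integrable_X_indicator)
  then show ?thesis by (simp add: prior_def Int_def conj_commute cong: conj_cong)
qed

text \<open>The minimum is squeezed between 0, almost everywhere, and the posterior of
  \<open>i\<close>, whose integral is the prior. This serves the pairs of total prior 0.\<close>

lemma integral_min_posterior_eq_0:
  assumes "i \<in> I" "prior \<Omega> X i = 0"
  shows "(\<integral>\<omega>. min (posterior \<Omega> N X Y i \<omega>) (posterior \<Omega> N X Y j \<omega>) \<partial>\<Omega>) = 0"
proof (rule antisym)
  have "(\<integral>\<omega>. min (posterior \<Omega> N X Y i \<omega>) (posterior \<Omega> N X Y j \<omega>) \<partial>\<Omega>) \<le> (\<integral>\<omega>. posterior \<Omega> N X Y i \<omega> \<partial>\<Omega>)"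
    by (intro integral_mono integrable_min_posterior) auto
  then show "(\<integral>\<omega>. min (posterior \<Omega> N X Y i \<omega>) (posterior \<Omega> N X Y j \<omega>) \<partial>\<Omega>) \<le> 0"
    using assms by (simp add: integral_posterior)
  show "0 \<le> (\<integral>\<omega>. min (posterior \<Omega> N X Y i \<omega>) (posterior \<Omega> N X Y j \<omega>) \<partial>\<Omega>)"
    using AE_posterior_nonneg[of i] AE_posterior_nonneg[of j] by (intro integral_nonneg_AE) auto
qed

text \<open>A binary rule is determined by the region where it decides for \<open>j\<close>, so the
  infimum over rules is one over measurable sets. The value \<open>v\<close> is kept abstract so
  that it can come from a test on another probability space.\<close>

lemma min_error_prob_binary:
  assumes I: "I = {i, j}" "i \<noteq> j"
  assumes least: "\<And>B. B \<in> sets N \<Longrightarrow>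
      v \<le> prior \<Omega> X i * measure (P i) B + prior \<Omega> X j * measure (P j) (space N - B)"
    and attained: "B\<^sub>0 \<in> sets N"
      "v = prior \<Omega> X i * measure (P i) B\<^sub>0 + prior \<Omega> X j * measure (P j) (space N - B\<^sub>0)"
  shows "min_error_prob \<Omega> I N X Y = v"
proof -
  have err: "\<P>(\<omega> in \<Omega>. X \<omega> \<noteq> L (Y \<omega>)) = prior \<Omega> X i * measure (P i) {y \<in> space N. L y = j}
      + prior \<Omega> X j * measure (P j) (space N - {y \<in> space N. L y = j})"
    if L: "L \<in> measurable N (count_space I)" for L
  proof -
    have "L y \<noteq> i \<longleftrightarrow> L y = j" if "y \<in> space N" for y
      using measurable_space[OF L that] I by auto
    then have "{y \<in> space N. L y \<noteq> i} = {y \<in> space N. L y = j}"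
      "{y \<in> space N. L y \<noteq> j} = space N - {y \<in> space N. L y = j}" by auto
    then show ?thesis using error_prob_eq_sum[OF L] I by simp
  qed
  show ?thesis unfolding min_error_prob_def
  proof (rule cInf_eq_minimum)
    \<comment> \<open>The rule whose region for \<open>j\<close> is exactly
      \<open>B\<^sub>0\<close>; it shows that the infimum is attained.\<close>
    let ?L = "\<lambda>y. if y \<in> B\<^sub>0 then j else i"
    have L: "?L \<in> measurable N (count_space I)"
      using attained(1) I by (intro measurable_If_set) auto
    have "{y \<in> space N. ?L y = j} = B\<^sub>0"
      using sets.sets_into_space[OF attained(1)] I by auto
    then have "v = \<P>(\<omega> in \<Omega>. X \<omega> \<noteq> ?L (Y \<omega>))" using err[OF L] attained(2) by simp
    with L show "v \<in> (\<lambda>L. \<P>(\<omega> in \<Omega>. X \<omega> \<noteq> L (Y \<omega>))) ` measurable N (count_space I)"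
      by (intro image_eqI[of _ _ ?L])
  next
    fix x assume "x \<in> (\<lambda>L. \<P>(\<omega> in \<Omega>. X \<omega> \<noteq> L (Y \<omega>))) ` measurable N (count_space I)"
    then obtain L where L: "L \<in> measurable N (count_space I)" and x: "x = \<P>(\<omega> in \<Omega>. X \<omega> \<noteq> L (Y \<omega>))"
      by blast
    have "{y \<in> space N. L y = j} \<in> sets N" using L by measurable
    then show "v \<le> x" using least err[OF L] x by simp
  qed
qed

section \<open>The upper bound by pairs\<close>

text \<open>The rule of maximal posterior is one competitor in the infimum. Its conditional error is
  bounded pointwise by \<open>sum_others_le_sum_pairs_min\<close>, almost everywhere because the
  posteriors are nonnegative only there.\<close>

lemma min_error_prob_le_sum_pairs:
  assumes I: "I = {1..M}"
  shows "min_error_prob \<Omega> I N X Y \<le> (\<Sum>(i, j) \<in> {(i, j). 1 \<le> i \<and> i < j \<and> j \<le> M}.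
    \<integral>\<omega>. min (posterior \<Omega> N X Y i \<omega>) (posterior \<Omega> N X Y j \<omega>) \<partial>\<Omega>)"
proof -
  let ?p = "posterior \<Omega> N X Y" and ?S = "{(i, j). 1 \<le> i \<and> i < j \<and> j \<le> M}"
  obtain L where L: "L \<in> measurable N (count_space I)"
    and max: "\<And>\<omega> i. \<omega> \<in> space \<Omega> \<Longrightarrow> i \<in> I \<Longrightarrow> ?p i \<omega> \<le> ?p (L (Y \<omega>)) \<omega>"
    by (rule obtain_maximal_posterior_rule) blast
  have nonneg: "AE \<omega> in \<Omega>. \<forall>i\<in>I. 0 \<le> ?p i \<omega>"
    using finite_hypotheses AE_posterior_nonneg by (intro AE_finite_allI) auto
  have "AE \<omega> in \<Omega>. (\<Sum>i\<in>I - {L (Y \<omega>)}. ?p i \<omega>) \<le> (\<Sum>(i, j)\<in>?S. min (?p i \<omega>) (?p j \<omega>))"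
    using nonneg AE_space
  proof eventually_elim
    case (elim \<omega>)
    then have "L (Y \<omega>) \<in> I" using measurable_space[OF L] Y_space by auto
    with elim max show ?case unfolding I by (intro sum_others_le_sum_pairs_min) auto
  qed
  \<comment> \<open>With the larger integrand nonnegative and integrable,
    \<open>integral_mono_AE'\<close> compares the integrals without a separate integrability proof
    for the smaller one.\<close>
  moreover have "AE \<omega> in \<Omega>. 0 \<le> (\<Sum>(i, j)\<in>?S. min (?p i \<omega>) (?p j \<omega>))"
    using nonneg by eventually_elim (auto simp: I intro!: sum_nonneg)
  moreover have "integrable \<Omega> (\<lambda>\<omega>. \<Sum>(i, j)\<in>?S. min (?p i \<omega>) (?p j \<omega>))"
    by (auto simp: case_prod_unfold intro!: integrable_min_posterior)
  ultimately have "\<P>(\<omega> in \<Omega>. X \<omega> \<noteq> L (Y \<omega>)) \<le> (\<integral>\<omega>. (\<Sum>(i, j)\<in>?S. min (?p i \<omega>) (?p j \<omega>)) \<partial>\<Omega>)"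
    unfolding error_prob_eq_integral[OF L] by (intro integral_mono_AE')
  also have "\<dots> = (\<Sum>(i, j)\<in>?S. \<integral>\<omega>. min (?p i \<omega>) (?p j \<omega>) \<partial>\<Omega>)"
    by (simp add: case_prod_unfold Bochner_Integration.integral_sum integrable_min_posterior)
  finally show ?thesis using min_error_prob_le[OF L] by linarith
qed

end

section \<open>Comparison with the binary tests\<close>

lemma integral_min_posterior_eq_binary_error:
  assumes T: "bayesian_test \<Omega> I N P X Y" and ij: "i \<in> I" "j \<in> I" "i \<noteq> j"
    and T\<^sub>2: "bayesian_test \<Omega>\<^sub>2 {i, j} N P X\<^sub>2 Y\<^sub>2"
    and c: "prior \<Omega> X i + prior \<Omega> X j > 0"
    and priors: "prior \<Omega>\<^sub>2 X\<^sub>2 i = prior \<Omega> X i / (prior \<Omega> X i + prior \<Omega> X j)"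
      "prior \<Omega>\<^sub>2 X\<^sub>2 j = prior \<Omega> X j / (prior \<Omega> X i + prior \<Omega> X j)"
  shows "(\<integral>\<omega>. min (posterior \<Omega> N X Y i \<omega>) (posterior \<Omega> N X Y j \<omega>) \<partial>\<Omega>) =
    (prior \<Omega> X i + prior \<Omega> X j) * min_error_prob \<Omega>\<^sub>2 {i, j} N X\<^sub>2 Y\<^sub>2"
proof -
  interpret T: bayesian_test \<Omega> I N P X Y by (rule T)
  interpret T\<^sub>2: bayesian_test \<Omega>\<^sub>2 "{i, j}" N P X\<^sub>2 Y\<^sub>2 by (rule T\<^sub>2)
  let ?c = "prior \<Omega> X i + prior \<Omega> X j"
  let ?v = "\<integral>\<omega>. min (posterior \<Omega> N X Y i \<omega>) (posterior \<Omega> N X Y j \<omega>) \<partial>\<Omega>"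
  \<comment> \<open>Normalizing the priors divides the objective by \<open>?c\<close> for every set
    at once, so the same \<open>B\<close> minimizes it in both tests.\<close>
  have scale: "prior \<Omega>\<^sub>2 X\<^sub>2 i * a + prior \<Omega>\<^sub>2 X\<^sub>2 j * b = (prior \<Omega> X i * a + prior \<Omega> X j * b) / ?c" for a b
    by (simp add: priors add_divide_distrib)
  obtain B where B: "B \<in> sets N"
    and v: "?v = prior \<Omega> X i * measure (P i) B + prior \<Omega> X j * measure (P j) (space N - B)"
    by (rule T.integral_min_posterior_attained[OF ij(1,2)])
  have "min_error_prob \<Omega>\<^sub>2 {i, j} N X\<^sub>2 Y\<^sub>2 = ?v / ?c"
  proof (rule T\<^sub>2.min_error_prob_binary[OF refl ij(3) _ B])
    show "?v / ?c \<le> prior \<Omega>\<^sub>2 X\<^sub>2 i * measure (P i) B + prior \<Omega>\<^sub>2 X\<^sub>2 j * measure (P j) (space N - B)"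
      if "B \<in> sets N" for B
      unfolding scale using T.integral_min_posterior_le[OF ij(1,2) that] c by (intro divide_right_mono) auto
  qed (simp only: scale v)
  then show ?thesis using c by simp
qed

theorem theorem14:
  fixes M :: nat
    and \<Omega> :: "'a measure" and N :: "'b measure" and P :: "nat \<Rightarrow> 'b measure"
    and X :: "'a \<Rightarrow> nat" and Y :: "'a \<Rightarrow> 'b"
    and \<Omega>\<^sub>2 :: "nat \<Rightarrow> nat \<Rightarrow> 'c measure"
    and X\<^sub>2 :: "nat \<Rightarrow> nat \<Rightarrow> 'c \<Rightarrow> nat" and Y\<^sub>2 :: "nat \<Rightarrow> nat \<Rightarrow> 'c \<Rightarrow> 'b"
  assumes "M \<ge> 2"
    and "bayesian_test \<Omega> {1..M} N P X Y"
    and "\<And>i j. 1 \<le> i \<Longrightarrow> i < j \<Longrightarrow> j \<le> M \<Longrightarrow> prior \<Omega> X i + prior \<Omega> X j > 0 \<Longrightarrow>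
      bayesian_test (\<Omega>\<^sub>2 i j) {i, j} N P (X\<^sub>2 i j) (Y\<^sub>2 i j) \<and>
      prior (\<Omega>\<^sub>2 i j) (X\<^sub>2 i j) i = prior \<Omega> X i / (prior \<Omega> X i + prior \<Omega> X j) \<and>
      prior (\<Omega>\<^sub>2 i j) (X\<^sub>2 i j) j = prior \<Omega> X j / (prior \<Omega> X i + prior \<Omega> X j)"
  shows "min_error_prob \<Omega> {1..M} N X Y \<le>
      (\<Sum>(i, j) \<in> {(i, j). 1 \<le> i \<and> i < j \<and> j \<le> M}.
        \<integral>\<omega>. min (posterior \<Omega> N X Y i \<omega>) (posterior \<Omega> N X Y j \<omega>) \<partial>\<Omega>) \<and>
    (\<Sum>(i, j) \<in> {(i, j). 1 \<le> i \<and> i < j \<and> j \<le> M}.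
        \<integral>\<omega>. min (posterior \<Omega> N X Y i \<omega>) (posterior \<Omega> N X Y j \<omega>) \<partial>\<Omega>) =
      (\<Sum>(i, j) \<in> {(i, j). 1 \<le> i \<and> i < j \<and> j \<le> M}.
        (prior \<Omega> X i + prior \<Omega> X j) *
          min_error_prob (\<Omega>\<^sub>2 i j) {i, j} N (X\<^sub>2 i j) (Y\<^sub>2 i j))"
proof (intro conjI)
  interpret T: bayesian_test \<Omega> "{1..M}" N P X Y by (rule assms(2))
  show "min_error_prob \<Omega> {1..M} N X Y \<le>
      (\<Sum>(i, j) \<in> {(i, j). 1 \<le> i \<and> i < j \<and> j \<le> M}.
        \<integral>\<omega>. min (posterior \<Omega> N X Y i \<omega>) (posterior \<Omega> N X Y j \<omega>) \<partial>\<Omega>)"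
    by (rule T.min_error_prob_le_sum_pairs[OF refl])
  show "(\<Sum>(i, j) \<in> {(i, j). 1 \<le> i \<and> i < j \<and> j \<le> M}.
        \<integral>\<omega>. min (posterior \<Omega> N X Y i \<omega>) (posterior \<Omega> N X Y j \<omega>) \<partial>\<Omega>) =
      (\<Sum>(i, j) \<in> {(i, j). 1 \<le> i \<and> i < j \<and> j \<le> M}.
        (prior \<Omega> X i + prior \<Omega> X j) *
          min_error_prob (\<Omega>\<^sub>2 i j) {i, j} N (X\<^sub>2 i j) (Y\<^sub>2 i j))"
  proof (rule sum.cong[OF refl], clarify)
    fix i j :: nat
    assume ij: "1 \<le> i" "i < j" "j \<le> M"
    show "(\<integral>\<omega>. min (posterior \<Omega> N X Y i \<omega>) (posterior \<Omega> N X Y j \<omega>) \<partial>\<Omega>) =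
      (prior \<Omega> X i + prior \<Omega> X j) * min_error_prob (\<Omega>\<^sub>2 i j) {i, j} N (X\<^sub>2 i j) (Y\<^sub>2 i j)"
    \<comment> \<open>For total prior 0 no binary test is assumed to exist; the factor 0 makes the
      right side vanish whatever value \<open>min_error_prob\<close> has.\<close>
    proof (cases "prior \<Omega> X i + prior \<Omega> X j > 0")
      case True
      then show ?thesis
        using assms(3)[OF ij True] ij
        by (intro integral_min_posterior_eq_binary_error[OF assms(2)]) auto
    next
      case False
      moreover have "prior \<Omega> X i \<ge> 0" "prior \<Omega> X j \<ge> 0" by (simp_all add: prior_def)
      ultimately have "prior \<Omega> X i = 0" "prior \<Omega> X j = 0" by linarith+
      then show ?thesis using T.integral_min_posterior_eq_0[of i j] ij by simp
    qed
  qed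
qed

end
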